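(* Let $x_1<x_2$ be real numbers and let $f:[x_1,x_2]\to\mathbb{R}$ be an absolutely continuous function on the interval $[x_1,x_2]$. Let $x_1<x<x_2$. Then $$ f(x)=\frac{1}{2\pi}\lim_{R\to\infty}\int_{-R}^{R} e^{ixs}\int_{x_1}^{x_2} e^{-ist}f(t)\,dt\,ds. $$
   Context: Integrals are Lebesgue integrals. *)

theory Defs
  imports "HOL-Analysis.Analysis"
begin

text \<open>
  The library's \<open>absolutely_continuous\<close> is a relation between measures; this is the
  epsilon-delta notion for functions on an interval \<open>S\<close>. A finite family of non-overlapping
  compact subintervals is given by its set of endpoint pairs; the intervals may share endpoints.
\<close>

definition absolutely_continuous_on :: "real set \<Rightarrow> (real \<Rightarrow> real) \<Rightarrow> bool" where
  "absolutely_continuous_on S f \<longleftrightarrow>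
     (\<forall>\<epsilon>>0. \<exists>\<delta>>0. \<forall>P :: (real \<times> real) set.
        finite P \<and> (\<forall>(a, b)\<in>P. a < b \<and> {a..b} \<subseteq> S) \<and>
        disjoint_family_on (\<lambda>(a, b). {a<..<b}) P \<and>
        (\<Sum>(a, b)\<in>P. b - a) < \<delta> \<longrightarrow>
        (\<Sum>(a, b)\<in>P. \<bar>f b - f a\<bar>) < \<epsilon>)"

end

theory Submission
  imports Defs "HOL-Probability.Sinc_Integral"
begin

text \<open>
  Exchanging the two integrals turns the truncated inversion integral into
  $2 \int f(t)\, D_R(t)\, dt$ with the Dirichlet kernel $D_R(t) = \sin(R(t-x))/(t-x)$, whose
  primitive is $\mathrm{Si}(R(t-x))$. The theorem therefore says that
  $\int f D_R \to \pi f(x)$. Because $\int D_R \to \pi$ (lemma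
  \<open>Si_at_top\<close>), it remains to show $\int g D_R \to 0$ for $g = f - f(x)$, which is
  \<open>dirichlet_integral_tendsto_0\<close>.

  The argument is that of Dirichlet and Jordan for functions of bounded variation. Its
  single estimate, \<open>abs_integral_mult_le_variation\<close>, is integration by
  parts on a grid: if $K$ is a primitive of $k$ and $|K| \le B$, then $|\int_a^b g k|$ is at most $B$
  times $|g(a)| + |g(b)|$ plus the variation of $g$. It is used in two ways.

  Near $x$, take $K = \mathrm{Si}(R(t-x))$, which is bounded uniformly in $R$. Absolute continuity
  makes the variation of $g$ on a short interval as small as desired, and $g$ itself is small there as
  $g(x) = 0$; so this part is small for all $R$ at once.

  Away from $x$, primitives can be shifted by a constant: $\mathrm{Si}(R(t-x)) \mp \pi/2$ tends to
  $0$ uniformly to the right and to the left of $x$ respectively. The estimate then gives convergence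
  to $0$ on every interval short enough for the variation to be at most 1, and such intervals are glued
  together (\<open>integral_tendsto_zero_if_primitive_vanishes\<close>).
\<close>

section \<open>Variation along uniform grids\<close>

definition grid :: "real \<Rightarrow> real \<Rightarrow> nat \<Rightarrow> nat \<Rightarrow> real" where
  "grid a b n i = a + (b - a) * (real i / real n)"

text \<open>
  Variation is only ever measured along uniform grids: since the functions are continuous, these grids
  suffice for the estimate by partial summation, and they avoid a supremum over all partitions.
\<close>

definition grid_variation :: "(real \<Rightarrow> real) \<Rightarrow> real \<Rightarrow> real \<Rightarrow> nat \<Rightarrow> real" where
  "grid_variation g a b n = (\<Sum>i<n. \<bar>g (grid a b n (Suc i)) - g (grid a b n i)\<bar>)"

lemma grid_0 [simp]: "grid a b n 0 = a"
  by (simp add: grid_def)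

lemma grid_end [simp]: "n > 0 \<Longrightarrow> grid a b n n = b"
  by (simp add: grid_def)

lemma grid_step: "n > 0 \<Longrightarrow> grid a b n (Suc i) - grid a b n i = (b - a) / real n"
  by (simp add: grid_def field_simps)

lemma grid_mono: "a \<le> b \<Longrightarrow> i \<le> j \<Longrightarrow> grid a b n i \<le> grid a b n j"
  by (simp add: grid_def divide_right_mono mult_left_mono)

lemma grid_strict_mono: "a < b \<Longrightarrow> n > 0 \<Longrightarrow> i < j \<Longrightarrow> grid a b n i < grid a b n j"
  by (simp add: grid_def divide_strict_right_mono)

lemma grid_bounds:
  assumes "a \<le> b" "i \<le> n" "n > 0"
  shows "a \<le> grid a b n i" "grid a b n i \<le> b"
  using grid_mono[OF assms(1), of 0 i n] grid_mono[OF assms(1,2), of n] assms by simp_all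

lemma absolutely_continuous_on_diff_const:
  "absolutely_continuous_on S f \<Longrightarrow> absolutely_continuous_on S (\<lambda>t. f t - c)"
  by (simp add: absolutely_continuous_on_def)

lemma absolutely_continuous_on_subset:
  assumes "absolutely_continuous_on S f" "T \<subseteq> S"
  shows "absolutely_continuous_on T f"
  unfolding absolutely_continuous_on_def
proof (intro allI impI)
  fix \<epsilon> :: real assume "\<epsilon> > 0"
  then obtain \<delta> where \<delta>: "\<delta> > 0" "\<And>P. finite P \<Longrightarrow> (\<forall>(a, b)\<in>P. a < b \<and> {a..b} \<subseteq> S) \<Longrightarrow>
        disjoint_family_on (\<lambda>(a, b). {a<..<b}) P \<Longrightarrow>
        (\<Sum>(a, b)\<in>P. b - a) < \<delta> \<Longrightarrow> (\<Sum>(a, b)\<in>P. \<bar>f b - f a\<bar>) < \<epsilon>"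
    using assms(1) unfolding absolutely_continuous_on_def by (metis (no_types, lifting))
  show "\<exists>\<delta>>0. \<forall>P. finite P \<and> (\<forall>(a, b)\<in>P. a < b \<and> {a..b} \<subseteq> T) \<and>
        disjoint_family_on (\<lambda>(a, b). {a<..<b}) P \<and>
        (\<Sum>(a, b)\<in>P. b - a) < \<delta> \<longrightarrow> (\<Sum>(a, b)\<in>P. \<bar>f b - f a\<bar>) < \<epsilon>"
    using \<delta> assms(2) by (intro exI[of _ \<delta>] conjI allI impI) (force intro!: \<delta>(2))+
qed

text \<open>
  The cells of a grid on $[a,b]$ form one of the families in the definition of absolute continuity,
  with total length $b - a$. Hence a single $\delta$ serves all short intervals and all grids on them.
\<close>

lemma absolutely_continuous_on_small_grid_variation:
  assumes ac: "absolutely_continuous_on {p..q} g" and "\<epsilon> > 0"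
  obtains \<delta> where "\<delta> > 0"
    "\<And>a b n. p \<le> a \<Longrightarrow> a < b \<Longrightarrow> b \<le> q \<Longrightarrow> b - a < \<delta> \<Longrightarrow> n > 0 \<Longrightarrow> grid_variation g a b n < \<epsilon>"
proof -
  obtain \<delta> where "\<delta> > 0" and \<delta>: "\<And>P. finite P \<Longrightarrow> (\<forall>(a, b)\<in>P. a < b \<and> {a..b} \<subseteq> {p..q}) \<Longrightarrow>
        disjoint_family_on (\<lambda>(a, b). {a<..<b}) P \<Longrightarrow>
        (\<Sum>(a, b)\<in>P. b - a) < \<delta> \<Longrightarrow> (\<Sum>(a, b)\<in>P. \<bar>g b - g a\<bar>) < \<epsilon>"
    using ac[unfolded absolutely_continuous_on_def, rule_format, OF \<open>\<epsilon> > 0\<close>]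
    by (metis (no_types, lifting))
  show ?thesis
  proof (rule that[OF \<open>\<delta> > 0\<close>])
    fix a b :: real and n :: nat
    assume ab: "p \<le> a" "a < b" "b \<le> q" "b - a < \<delta>" and n: "n > 0"
    let ?t = "grid a b n"
    let ?h = "\<lambda>i. (?t i, ?t (Suc i))"
    let ?P = "?h ` {..<n}"
    have inj: "inj_on ?h {..<n}"
      using grid_strict_mono[OF ab(2) n] by (intro inj_onI) (metis linorder_neqE_nat order_less_irrefl prod.inject)
    have "(\<Sum>(a, b)\<in>?P. \<bar>g b - g a\<bar>) < \<epsilon>"
    proof (rule \<delta>)
      show "finite ?P" by simp
      have "?t i < ?t (Suc i) \<and> {?t i..?t (Suc i)} \<subseteq> {p..q}" if "i < n" for i
        using grid_strict_mono[of a b n i "Suc i"] grid_bounds[of a b i n]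
          grid_bounds[of a b "Suc i" n] ab n that by auto
      then show "\<forall>(a, b)\<in>?P. a < b \<and> {a..b} \<subseteq> {p..q}"
        by simp
      have "{?t i<..<?t (Suc i)} \<inter> {?t j<..<?t (Suc j)} = {}" if "i < j" for i j
        using grid_mono[of a b "Suc i" j n] ab that by auto
      then have disj: "{?t i<..<?t (Suc i)} \<inter> {?t j<..<?t (Suc j)} = {}" if "i \<noteq> j" for i j
        using that by (metis Int_commute linorder_neqE_nat)
      show "disjoint_family_on (\<lambda>(a, b). {a<..<b}) ?P"
        unfolding disjoint_family_on_def
      proof (intro ballI impI)
        fix u v assume "u \<in> ?P" "v \<in> ?P" "u \<noteq> v"
        then obtain i j where uv: "u = ?h i" "v = ?h j" and "i \<noteq> j" by blast
        show "(\<lambda>(a, b). {a<..<b}) u \<inter> (\<lambda>(a, b). {a<..<b}) v = {}"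
          unfolding uv prod.case using \<open>i \<noteq> j\<close> by (rule disj)
      qed
      have "(\<Sum>(a, b)\<in>?P. b - a) = (\<Sum>i<n. ?t (Suc i) - ?t i)"
        by (simp add: sum.reindex[OF inj])
      also have "\<dots> = b - a"
        using n by (simp add: sum_lessThan_telescope)
      finally show "(\<Sum>(a, b)\<in>?P. b - a) < \<delta>" using ab by simp
    qed
    then show "grid_variation g a b n < \<epsilon>"
      by (simp add: sum.reindex[OF inj] grid_variation_def)
  qed
qed

text \<open>The grid with one cell.\<close>

lemma absolutely_continuous_on_small_increment:
  assumes ac: "absolutely_continuous_on {p..q} g" and "\<epsilon> > 0"
  obtains \<delta> where "\<delta> > 0"
    "\<And>a b. a \<in> {p..q} \<Longrightarrow> b \<in> {p..q} \<Longrightarrow> \<bar>b - a\<bar> < \<delta> \<Longrightarrow> \<bar>g b - g a\<bar> < \<epsilon>"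
proof -
  obtain \<delta> where "\<delta> > 0" and \<delta>:
    "\<And>a b n. p \<le> a \<Longrightarrow> a < b \<Longrightarrow> b \<le> q \<Longrightarrow> b - a < \<delta> \<Longrightarrow> n > 0 \<Longrightarrow> grid_variation g a b n < \<epsilon>"
    using absolutely_continuous_on_small_grid_variation[OF assms] by blast
  have *: "\<bar>g b - g a\<bar> < \<epsilon>" if "p \<le> a" "a < b" "b \<le> q" "b - a < \<delta>" for a b
    using \<delta>[OF that, of 1] grid_end[of 1 a b] by (simp add: grid_variation_def)
  show ?thesis
  proof (rule that[OF \<open>\<delta> > 0\<close>])
    fix a b assume "a \<in> {p..q}" "b \<in> {p..q}" "\<bar>b - a\<bar> < \<delta>"
    then show "\<bar>g b - g a\<bar> < \<epsilon>"
      using *[of a b] *[of b a] \<open>\<epsilon> > 0\<close> by (cases a b rule: linorder_cases) (auto simp: abs_minus_commute)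
  qed
qed

lemma absolutely_continuous_on_imp_continuous_on:
  assumes "absolutely_continuous_on {p..q} g"
  shows "continuous_on {p..q} g"
  unfolding continuous_on_iff dist_real_def
  by (metis absolutely_continuous_on_small_increment[OF assms])

section \<open>A bound by partial summation\<close>

lemma sum_by_parts:
  fixes u v :: "nat \<Rightarrow> real"
  shows "(\<Sum>i<n. u i * (v (Suc i) - v i)) =
           u n * v n - u 0 * v 0 - (\<Sum>i<n. v (Suc i) * (u (Suc i) - u i))"
  by (induction n) (simp_all add: algebra_simps)

lemma integral_grid_sum:
  fixes h :: "real \<Rightarrow> real"
  assumes h: "h integrable_on {a..b}" and "a \<le> b" "n > 0"
  shows "integral {a..b} h = (\<Sum>i<n. integral {grid a b n i..grid a b n (Suc i)} h)"
proof -
  have "m \<le> n \<Longrightarrow> integral {a..grid a b n m} h = (\<Sum>i<m. integral {grid a b n i..grid a b n (Suc i)} h)" for m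
  proof (induction m)
    case (Suc m)
    have "integral {a..grid a b n m} h + integral {grid a b n m..grid a b n (Suc m)} h
            = integral {a..grid a b n (Suc m)} h"
      using Suc.prems assms grid_bounds[of a b m n] grid_bounds[of a b "Suc m" n]
      by (intro Henstock_Kurzweil_Integration.integral_combine grid_mono
            integrable_subinterval_real[OF h]) auto
    with Suc show ?case by simp
  qed simp
  from this[of n] assms show ?thesis by simp
qed

lemma has_integral_primitive:
  fixes k K :: "real \<Rightarrow> real"
  assumes "a \<le> b" and K: "\<And>t. t \<in> {a..b} \<Longrightarrow> (K has_real_derivative k t) (at t)"
  shows "(k has_integral (K b - K a)) {a..b}"
  using assms(1) has_field_derivative_at_within[OF K]
  by (intro fundamental_theorem_of_calculus)
    (auto simp flip: has_real_derivative_iff_has_vector_derivative)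

text \<open>
  Replacing $g$ on each cell by its value at the left end turns the integral into
  $\sum_i g(t_i) (K(t_{i+1}) - K(t_i))$; uniform continuity of $g$ makes the error arbitrarily small.
  Partial summation moves the differences from $K$ to $g$, after which only the size of $K$ matters.
  This is the point: $k$ may be large and oscillating while $K$ stays bounded.
\<close>

lemma abs_integral_mult_le_variation:
  fixes g k K :: "real \<Rightarrow> real"
  assumes ab: "a < b"
    and g: "continuous_on {a..b} g" and k: "continuous_on {a..b} k"
    and K: "\<And>t. t \<in> {a..b} \<Longrightarrow> (K has_real_derivative k t) (at t)"
    and B: "\<And>t. t \<in> {a..b} \<Longrightarrow> \<bar>K t\<bar> \<le> B"
    and V: "\<And>n. n > 0 \<Longrightarrow> grid_variation g a b n \<le> V"
  shows "\<bar>integral {a..b} (\<lambda>t. g t * k t)\<bar> \<le> B * (\<bar>g a\<bar> + \<bar>g b\<bar> + V)"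
proof (rule field_le_epsilon)
  fix e :: real assume e: "e > 0"
  obtain M where M: "M > 0" "\<And>t. t \<in> {a..b} \<Longrightarrow> \<bar>k t\<bar> \<le> M"
    using compact_imp_bounded[OF compact_continuous_image[OF k compact_Icc]]
    by (auto simp: bounded_pos)
  \<comment> \<open>An oscillation of at most \<open>\<eta>\<close> per cell costs \<open>\<eta> * M * (b - a) = e\<close> in total.\<close>
  define \<eta> where "\<eta> = e / (M * (b - a))"
  have \<eta>: "\<eta> > 0" using e M ab by (simp add: \<eta>_def)
  obtain d where d: "d > 0" "\<And>s t. s \<in> {a..b} \<Longrightarrow> t \<in> {a..b} \<Longrightarrow> \<bar>t - s\<bar> < d \<Longrightarrow> \<bar>g t - g s\<bar> < \<eta>"
    using compact_uniformly_continuous[OF g compact_Icc] \<eta>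
    unfolding uniformly_continuous_on_def dist_real_def by metis
  obtain n where n0: "(b - a) / d < real n" using reals_Archimedean2 by blast
  have n: "n > 0" using n0 ab d by (cases n) (auto simp: field_simps)
  have step: "(b - a) / real n < d" using n0 n d by (simp add: field_simps)
  let ?t = "grid a b n"
  have tI: "?t i \<in> {a..b}" if "i \<le> n" for i using grid_bounds[of a b i n] that ab n by auto
  have sub: "{?t i..?t (Suc i)} \<subseteq> {a..b}" if "i < n" for i
    using tI[of i] tI[of "Suc i"] that by auto
  have cell: "\<bar>integral {?t i..?t (Suc i)} (\<lambda>t. g t * k t) - g (?t i) * (K (?t (Suc i)) - K (?t i))\<bar>
               \<le> e / n" if i: "i < n" for i
  proof -
    have le: "?t i \<le> ?t (Suc i)" using grid_mono[of a b i "Suc i" n] ab by simp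
    have gk: "(\<lambda>t. g t * k t) integrable_on {?t i..?t (Suc i)}"
      by (intro integrable_continuous_real continuous_on_subset[OF _ sub[OF i]] continuous_intros g k)
    have "(k has_integral (K (?t (Suc i)) - K (?t i))) {?t i..?t (Suc i)}"
      using sub[OF i] by (intro has_integral_primitive le K) auto
    from has_integral_mult_right[OF this, of "g (?t i)"] gk
    have hi: "((\<lambda>t. g t * k t - g (?t i) * k t) has_integral
        (integral {?t i..?t (Suc i)} (\<lambda>t. g t * k t) - g (?t i) * (K (?t (Suc i)) - K (?t i))))
        (cbox (?t i) (?t (Suc i)))"
      by (auto intro!: has_integral_diff)
    have "norm (integral {?t i..?t (Suc i)} (\<lambda>t. g t * k t) - g (?t i) * (K (?t (Suc i)) - K (?t i)))
          \<le> \<eta> * M * measure lborel (cbox (?t i) (?t (Suc i)))"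
    proof (rule has_integral_bound[OF _ hi])
      fix t assume "t \<in> cbox (?t i) (?t (Suc i))"
      then have t: "t \<in> {?t i..?t (Suc i)}" by simp
      then have "\<bar>t - ?t i\<bar> < d" using step grid_step[OF n, of a b i] by auto
      then have "\<bar>g t - g (?t i)\<bar> \<le> \<eta>" using d(2)[of "?t i" t] tI[of i] sub[OF i] t i by force
      moreover have "\<bar>k t\<bar> \<le> M" using M(2) sub[OF i] t by blast
      ultimately have "\<bar>g t - g (?t i)\<bar> * \<bar>k t\<bar> \<le> \<eta> * M" using \<eta> by (intro mult_mono) auto
      then show "norm (g t * k t - g (?t i) * k t) \<le> \<eta> * M"
        by (simp add: abs_mult flip: left_diff_distrib)
    qed (use \<eta> M in simp)
    also have "\<dots> = \<eta> * M * ((b - a) / n)" using le grid_step[OF n] by simp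
    also have "\<dots> = e / n" using M ab n by (simp add: \<eta>_def)
    finally show ?thesis by simp
  qed
  define S where "S = (\<Sum>i<n. g (?t i) * (K (?t (Suc i)) - K (?t i)))"
  have "integral {a..b} (\<lambda>t. g t * k t) = (\<Sum>i<n. integral {?t i..?t (Suc i)} (\<lambda>t. g t * k t))"
    using ab n by (intro integral_grid_sum integrable_continuous_real continuous_intros g k) auto
  then have "integral {a..b} (\<lambda>t. g t * k t) - S = (\<Sum>i<n.
      integral {?t i..?t (Suc i)} (\<lambda>t. g t * k t) - g (?t i) * (K (?t (Suc i)) - K (?t i)))"
    by (simp add: S_def sum_subtractf)
  also have "\<bar>\<dots>\<bar> \<le> (\<Sum>i<n. e / n)"
    by (intro order_trans[OF sum_abs] sum_mono cell) simp
  finally have 1: "\<bar>integral {a..b} (\<lambda>t. g t * k t) - S\<bar> \<le> e" using n by simp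
  have S: "S = g b * K b - g a * K a - (\<Sum>i<n. K (?t (Suc i)) * (g (?t (Suc i)) - g (?t i)))"
    unfolding S_def using sum_by_parts[of "\<lambda>i. g (?t i)" "\<lambda>i. K (?t i)" n] n by simp
  have "\<bar>\<Sum>i<n. K (?t (Suc i)) * (g (?t (Suc i)) - g (?t i))\<bar>
      \<le> (\<Sum>i<n. B * \<bar>g (?t (Suc i)) - g (?t i)\<bar>)"
    using B tI by (intro order_trans[OF sum_abs] sum_mono) (auto simp: abs_mult intro!: mult_right_mono)
  also have "\<dots> = B * grid_variation g a b n" by (simp add: grid_variation_def sum_distrib_left)
  also have "\<dots> \<le> B * V" using V[OF n] B[of a] ab by (intro mult_left_mono) auto
  finally have 2: "\<bar>\<Sum>i<n. K (?t (Suc i)) * (g (?t (Suc i)) - g (?t i))\<bar> \<le> B * V" .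
  have 3: "\<bar>g b * K b\<bar> \<le> B * \<bar>g b\<bar>" "\<bar>g a * K a\<bar> \<le> B * \<bar>g a\<bar>"
    using B[of a] B[of b] ab by (auto simp: abs_mult mult.commute[of B] intro!: mult_left_mono)
  show "\<bar>integral {a..b} (\<lambda>t. g t * k t)\<bar> \<le> B * (\<bar>g a\<bar> + \<bar>g b\<bar> + V) + e"
    using 1 2 3 S by (simp add: distrib_left)
qed

section \<open>Kernels with vanishing primitives\<close>

text \<open>
  On an interval where every grid variation of $g$ is below 1, the bound above has a constant that
  does not depend on the parameter, so the integral vanishes with the primitive. Both the hypothesis
  and the conclusion localise, and additivity of the integral lets the bisection principle
  \<open>Bolzano\<close> pass from short intervals to the whole one.
\<close>

lemma integral_tendsto_zero_if_primitive_vanishes: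
  fixes g :: "real \<Rightarrow> real" and k K :: "real \<Rightarrow> real \<Rightarrow> real"
  assumes "p \<le> q" and ac: "absolutely_continuous_on {p..q} g"
    and k: "\<And>R. continuous_on {p..q} (k R)"
    and K: "\<And>R t. t \<in> {p..q} \<Longrightarrow> (K R has_real_derivative k R t) (at t)"
    and lim: "uniform_limit {p..q} K (\<lambda>_. 0) F"
  shows "((\<lambda>R. integral {p..q} (\<lambda>t. g t * k R t)) \<longlongrightarrow> 0) F"
proof -
  have g: "continuous_on {p..q} g"
    using ac by (rule absolutely_continuous_on_imp_continuous_on)
  obtain \<delta> where \<delta>: "\<delta> > 0"
    "\<And>a b n. p \<le> a \<Longrightarrow> a < b \<Longrightarrow> b \<le> q \<Longrightarrow> b - a < \<delta> \<Longrightarrow> n > 0 \<Longrightarrow> grid_variation g a b n < 1"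
    using absolutely_continuous_on_small_grid_variation[OF ac zero_less_one] by blast
  \<comment> \<open>The guards keep \<open>p\<close> and \<open>q\<close> fixed while the interval shrinks.\<close>
  define P where "P u v \<longleftrightarrow>
    (p \<le> u \<longrightarrow> v \<le> q \<longrightarrow> ((\<lambda>R. integral {u..v} (\<lambda>t. g t * k R t)) \<longlongrightarrow> 0) F)" for u v
  have "P p q"
    using \<open>p \<le> q\<close>
  proof (induction p q rule: Bolzano)
    case (trans a b c)
    show ?case
      unfolding P_def
    proof safe
      assume "p \<le> a" "c \<le> q"
      then have "((\<lambda>R. integral {a..b} (\<lambda>t. g t * k R t) + integral {b..c} (\<lambda>t. g t * k R t)) \<longlongrightarrow> 0 + 0) F"
        using trans by (intro tendsto_add) (auto simp: P_def)
      moreover have "integral {a..b} (\<lambda>t. g t * k R t) + integral {b..c} (\<lambda>t. g t * k R t)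
          = integral {a..c} (\<lambda>t. g t * k R t)" for R
        using trans \<open>p \<le> a\<close> \<open>c \<le> q\<close>
        by (intro Henstock_Kurzweil_Integration.integral_combine integrable_continuous_real continuous_intros
             continuous_on_subset[OF g] continuous_on_subset[OF k]) auto
      ultimately show "((\<lambda>R. integral {a..c} (\<lambda>t. g t * k R t)) \<longlongrightarrow> 0) F" by simp
    qed
  next
    case (local y)
    have "((\<lambda>R. integral {a..b} (\<lambda>t. g t * k R t)) \<longlongrightarrow> 0) F"
      if ab: "p \<le> a" "b \<le> q" "b - a < \<delta>" "a \<le> y" "y \<le> b" for a b
    proof (cases "a = b")
      case False
      then have "a < b" using ab by simp
      define C where "C = \<bar>g a\<bar> + \<bar>g b\<bar> + 1"
      have "C > 0" by (simp add: C_def)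
      show ?thesis
      proof (rule tendstoI)
        fix e :: real assume "e > 0"
        then have "e / (2 * C) > 0" using \<open>C > 0\<close> by simp
        with lim have "\<forall>\<^sub>F R in F. \<forall>t\<in>{p..q}. dist (K R t) 0 < e / (2 * C)"
          by (auto simp: uniform_limit_iff)
        then show "\<forall>\<^sub>F R in F. dist (integral {a..b} (\<lambda>t. g t * k R t)) 0 < e"
        proof eventually_elim
          case (elim R)
          have sub: "{a..b} \<subseteq> {p..q}" using ab by auto
          have "\<bar>integral {a..b} (\<lambda>t. g t * k R t)\<bar> \<le> e / (2 * C) * C"
            unfolding C_def[symmetric] using elim sub ab \<open>a < b\<close>
            by (subst (2) C_def, intro abs_integral_mult_le_variation[where K = "K R"] K
                  continuous_on_subset[OF g] continuous_on_subset[OF k] less_imp_le[OF \<delta>(2)])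
               (auto intro: less_imp_le)
          also have "\<dots> < e" using \<open>C > 0\<close> \<open>e > 0\<close> by simp
          finally show ?case by simp
        qed
      qed
    qed simp
    then show ?case using \<delta>(1) unfolding P_def by blast
  qed
  then show ?thesis by (simp add: P_def)
qed

section \<open>The Dirichlet kernel\<close>

text \<open>
  This is $\sin(R(t-x))/(t-x)$, written through \<open>sinc\<close> so that it is continuous at $t = x$,
  with value $R$ there.
\<close>

definition dirichlet_kernel :: "real \<Rightarrow> real \<Rightarrow> real \<Rightarrow> real" where
  "dirichlet_kernel x R t = R * sinc (R * (t - x))"

lemma continuous_on_dirichlet_kernel: "continuous_on S (dirichlet_kernel x R)"
  unfolding dirichlet_kernel_def by (intro continuous_intros)

text \<open>
  The free constant allows a different primitive on each side of $x$.
\<close>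

lemma DERIV_Si_dirichlet_kernel:
  "((\<lambda>t. Si (R * (t - x)) - c) has_real_derivative dirichlet_kernel x R t) (at t)"
  unfolding dirichlet_kernel_def
  by (rule derivative_eq_intros DERIV_chain2[OF DERIV_Si] refl | simp)+

lemma Si_minus: "Si (- u) = - Si u"
  using Si_neg[of u] Si_neg[of "- u"] by (cases "u \<ge> 0") auto

text \<open>
  To the right of $x$ the argument $R(t-x)$ is at least $R(p-x)$, which tends to infinity.
\<close>

lemma Si_uniform_limit_right:
  assumes "x < p"
  shows "uniform_limit {p..q} (\<lambda>R t. Si (R * (t - x)) - pi / 2) (\<lambda>_. 0) at_top"
  unfolding uniform_limit_iff
proof safe
  fix e :: real assume "e > 0"
  with Si_at_top have "\<forall>\<^sub>F u in at_top. dist (Si u) (pi / 2) < e" by (rule tendstoD)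
  then obtain N where N: "\<And>u. u \<ge> N \<Longrightarrow> dist (Si u) (pi / 2) < e"
    by (auto simp: eventually_at_top_linorder)
  show "\<forall>\<^sub>F R in at_top. \<forall>t\<in>{p..q}. dist (Si (R * (t - x)) - pi / 2) 0 < e"
    using eventually_ge_at_top[of "max 0 (N / (p - x))"]
  proof eventually_elim
    case (elim R)
    have "N \<le> R * (t - x)" if "t \<in> {p..q}" for t
    proof -
      have "N \<le> R * (p - x)" using elim assms by (simp add: field_simps)
      also have "\<dots> \<le> R * (t - x)" using elim that by (intro mult_left_mono) auto
      finally show ?thesis .
    qed
    then show ?case using N by (auto simp: dist_real_def)
  qed
qed

text \<open>Reflection $t \mapsto -t$ of the previous lemma, as \<open>Si\<close> is odd.\<close>

lemma Si_uniform_limit_left: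
  assumes "q < x"
  shows "uniform_limit {p..q} (\<lambda>R t. Si (R * (t - x)) - (- (pi / 2))) (\<lambda>_. 0) at_top"
  unfolding uniform_limit_iff
proof safe
  fix e :: real assume "e > 0"
  with Si_uniform_limit_right[of "- x" "- q" "- p"] assms
  have "\<forall>\<^sub>F R in at_top. \<forall>t\<in>{- q..- p}. dist (Si (R * (t - (- x))) - pi / 2) 0 < e"
    by (auto simp: uniform_limit_iff)
  then show "\<forall>\<^sub>F R in at_top. \<forall>t\<in>{p..q}. dist (Si (R * (t - x)) - (- (pi / 2))) 0 < e"
  proof eventually_elim
    case (elim R)
    show ?case
    proof
      fix t assume "t \<in> {p..q}"
      then have "dist (Si (R * (- t - (- x))) - pi / 2) 0 < e" by (intro bspec[OF elim]) simp
      moreover have "R * (- t - (- x)) = - (R * (t - x))" by (simp add: algebra_simps)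
      then have "Si (R * (- t - (- x))) = - Si (R * (t - x))" by (simp only: Si_minus)
      ultimately show "dist (Si (R * (t - x)) - (- (pi / 2))) 0 < e"
        unfolding dist_real_def by linarith
    qed
  qed
qed

text \<open>
  The interval is split at $x - r$ and $x + r$. The middle part is small uniformly in $R$ by the choice
  of $r$; the two outer parts tend to 0 for this fixed $r$.
\<close>

lemma dirichlet_integral_tendsto_0:
  assumes ac: "absolutely_continuous_on {p..q} g" and x: "p < x" "x < q" and gx: "g x = 0"
  shows "((\<lambda>R. integral {p..q} (\<lambda>t. g t * dirichlet_kernel x R t)) \<longlongrightarrow> 0) at_top"
proof (rule tendstoI)
  fix e :: real assume "e > 0"
  have g: "continuous_on {p..q} g"
    using ac by (rule absolutely_continuous_on_imp_continuous_on)
  have sub_ac: "absolutely_continuous_on {a..b} g" if "p \<le> a" "b \<le> q" for a b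
    using that by (intro absolutely_continuous_on_subset[OF ac]) auto
  obtain C where C: "\<And>u. \<bar>Si u\<bar> \<le> C" using bounded_Si by blast
  \<comment> \<open>The middle part is at most \<open>C\<close> times two boundary values and one variation, each below
      \<open>\<eta>\<close>; the constant 6 leaves half of \<open>e\<close> for the outer parts.\<close>
  define \<eta> where "\<eta> = e / (6 * (\<bar>C\<bar> + 1))"
  have \<eta>: "\<eta> > 0" using \<open>e > 0\<close> by (simp add: \<eta>_def)
  obtain \<delta>1 where \<delta>1: "\<delta>1 > 0"
    "\<And>a b n. p \<le> a \<Longrightarrow> a < b \<Longrightarrow> b \<le> q \<Longrightarrow> b - a < \<delta>1 \<Longrightarrow> n > 0 \<Longrightarrow> grid_variation g a b n < \<eta>"
    using absolutely_continuous_on_small_grid_variation[OF ac \<eta>] by blast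
  obtain \<delta>2 where \<delta>2: "\<delta>2 > 0"
    "\<And>a b. a \<in> {p..q} \<Longrightarrow> b \<in> {p..q} \<Longrightarrow> \<bar>b - a\<bar> < \<delta>2 \<Longrightarrow> \<bar>g b - g a\<bar> < \<eta>"
    using absolutely_continuous_on_small_increment[OF ac \<eta>] by blast
  define r where "r = min (min (x - p) (q - x)) (min \<delta>1 \<delta>2) / 3"
  have "3 * r \<le> x - p" "3 * r \<le> q - x" "3 * r \<le> \<delta>1" "3 * r \<le> \<delta>2" "r > 0"
    using x \<delta>1(1) \<delta>2(1) by (auto simp: r_def)
  then have r: "r > 0" "p < x - r" "x + r < q" "2 * r < \<delta>1" "r < \<delta>2"
    by linarith+
  have small: "\<bar>g (x - r)\<bar> < \<eta>" "\<bar>g (x + r)\<bar> < \<eta>"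
    using \<delta>2(2)[of x "x - r"] \<delta>2(2)[of x "x + r"] r x gx by auto
  let ?D = "dirichlet_kernel x"
  let ?I = "\<lambda>R a b. integral {a..b} (\<lambda>t. g t * ?D R t)"
  have integrable: "(\<lambda>t. g t * ?D R t) integrable_on {a..b}" if "p \<le> a" "b \<le> q" for R a b
    using that by (intro integrable_continuous_real continuous_intros continuous_on_dirichlet_kernel
        continuous_on_subset[OF g]) auto
  have split: "?I R p q = ?I R p (x - r) + ?I R (x - r) (x + r) + ?I R (x + r) q" for R
    using Henstock_Kurzweil_Integration.integral_combine[OF _ _ integrable, of p "x - r" q R]
      Henstock_Kurzweil_Integration.integral_combine[OF _ _ integrable, of "x - r" "x + r" q R] r by simp
  have mid: "\<bar>?I R (x - r) (x + r)\<bar> < e / 2" for R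
  proof -
    have "\<bar>?I R (x - r) (x + r)\<bar> \<le> C * (\<bar>g (x - r)\<bar> + \<bar>g (x + r)\<bar> + \<eta>)"
      using r C DERIV_Si_dirichlet_kernel[of R x 0]
      by (intro abs_integral_mult_le_variation[where K = "\<lambda>t. Si (R * (t - x))"] continuous_on_subset[OF g]
           continuous_on_dirichlet_kernel less_imp_le[OF \<delta>1(2)]) auto
    also have "\<dots> \<le> \<bar>C\<bar> * (3 * \<eta>)" using small by (intro mult_mono) auto
    also have "\<dots> < (\<bar>C\<bar> + 1) * (3 * \<eta>)" using \<eta> by simp
    also have "\<dots> = e / 2" by (simp add: \<eta>_def field_simps)
    finally show ?thesis .
  qed
  have left: "((\<lambda>R. ?I R p (x - r)) \<longlongrightarrow> 0) at_top"
    using r by (intro integral_tendsto_zero_if_primitive_vanishes[OF _ _ _ DERIV_Si_dirichlet_kernel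
          Si_uniform_limit_left] sub_ac continuous_on_dirichlet_kernel) auto
  have right: "((\<lambda>R. ?I R (x + r) q) \<longlongrightarrow> 0) at_top"
    using r by (intro integral_tendsto_zero_if_primitive_vanishes[OF _ _ _ DERIV_Si_dirichlet_kernel
          Si_uniform_limit_right] sub_ac continuous_on_dirichlet_kernel) auto
  have "((\<lambda>R. ?I R p (x - r) + ?I R (x + r) q) \<longlongrightarrow> 0 + 0) at_top"
    by (intro tendsto_add left right)
  then have "\<forall>\<^sub>F R in at_top. dist (?I R p (x - r) + ?I R (x + r) q) 0 < e / 2"
    using \<open>e > 0\<close> by (intro tendstoD) auto
  then show "\<forall>\<^sub>F R in at_top. dist (?I R p q) 0 < e"
  proof eventually_elim
    case (elim R)
    then show ?case using mid[of R] split[of R] unfolding dist_real_def by linarith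
  qed
qed

text \<open>Subtracting the constant $f(x)$ reduces this to the previous lemma and $\int D_R \to \pi$.\<close>

lemma dirichlet_integral_tendsto:
  assumes ac: "absolutely_continuous_on {p..q} f" and x: "p < x" "x < q"
  shows "((\<lambda>R. integral {p..q} (\<lambda>t. f t * dirichlet_kernel x R t)) \<longlongrightarrow> pi * f x) at_top"
proof -
  let ?D = "dirichlet_kernel x"
  have f: "continuous_on {p..q} f"
    using ac by (rule absolutely_continuous_on_imp_continuous_on)
  have D: "(?D R has_integral (Si (R * (q - x)) - Si (R * (p - x)))) {p..q}" for R
    using x has_integral_primitive[OF _ DERIV_Si_dirichlet_kernel, of p q x R 0] by simp
  have eq: "integral {p..q} (\<lambda>t. f t * ?D R t) =
      integral {p..q} (\<lambda>t. (f t - f x) * ?D R t) + f x * (Si (R * (q - x)) - Si (R * (p - x)))" for R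
  proof -
    have "(\<lambda>t. (f t - f x) * ?D R t) integrable_on {p..q}"
      by (intro integrable_continuous_real continuous_intros continuous_on_dirichlet_kernel f)
    from has_integral_add[OF integrable_integral[OF this] has_integral_mult_right[OF D[of R], of "f x"]]
    show ?thesis by (intro integral_unique) (simp add: algebra_simps)
  qed
  have S1: "((\<lambda>R. Si (R * (q - x))) \<longlongrightarrow> pi / 2) at_top"
    using x by (intro filterlim_compose[OF Si_at_top] filterlim_at_top_mult_tendsto_pos[where c = "q - x"]
        tendsto_const filterlim_ident) simp
  have S3: "((\<lambda>R. Si (R * (x - p))) \<longlongrightarrow> pi / 2) at_top"
    using x by (intro filterlim_compose[OF Si_at_top] filterlim_at_top_mult_tendsto_pos[where c = "x - p"]
        tendsto_const filterlim_ident) simp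
  have "Si (R * (p - x)) = - Si (R * (x - p))" for R
    using Si_minus[of "R * (x - p)"] by (simp add: algebra_simps)
  then have S2: "((\<lambda>R. Si (R * (p - x))) \<longlongrightarrow> - (pi / 2)) at_top"
    using tendsto_minus[OF S3] by simp
  have "((\<lambda>R. integral {p..q} (\<lambda>t. (f t - f x) * ?D R t) + f x * (Si (R * (q - x)) - Si (R * (p - x))))
      \<longlongrightarrow> 0 + f x * (pi / 2 - (- (pi / 2)))) at_top"
    using x by (intro tendsto_intros S1 S2 dirichlet_integral_tendsto_0 absolutely_continuous_on_diff_const ac) auto
  then show ?thesis by (simp add: eq mult.commute)
qed

section \<open>Reduction of the inversion integral to the Dirichlet kernel\<close>

lemma has_integral_exp_dirichlet_kernel:
  assumes "R \<ge> 0"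
  shows "((\<lambda>s. exp (\<i> * complex_of_real x * complex_of_real s) * exp (- \<i> * complex_of_real s * complex_of_real t))
     has_integral complex_of_real (2 * dirichlet_kernel x R t)) {-R..R}"
proof -
  define u where "u = x - t"
  have int: "exp (\<i> * complex_of_real x * complex_of_real s) * exp (- \<i> * complex_of_real s * complex_of_real t)
      = exp (\<i> * of_real u * of_real s)" for s
    by (simp add: u_def algebra_simps flip: exp_add)
  show ?thesis unfolding int
  proof (cases "u = 0")
    case True
    then have "t = x" by (simp add: u_def)
    then show "((\<lambda>s. exp (\<i> * of_real u * of_real s)) has_integral complex_of_real (2 * dirichlet_kernel x R t)) {-R..R}"
      using has_integral_const_real[of "1::complex" "-R" R] assms True
      by (simp add: dirichlet_kernel_def scaleR_conv_of_real)
  next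
    case False
    let ?E = "\<lambda>s. exp (\<i> * of_real u * of_real s) / (\<i> * of_real u)"
    have "(?E has_vector_derivative exp (\<i> * of_real u * of_real s)) (at s within {-R..R})" for s
    proof -
      have "((\<lambda>z. exp (\<i> * of_real u * z) / (\<i> * of_real u)) has_field_derivative exp (\<i> * of_real u * of_real s))
          (at (of_real s))"
        using False by (auto intro!: derivative_eq_intros)
      then show ?thesis
        by (rule has_vector_derivative_real_field)
    qed
    then have "((\<lambda>s. exp (\<i> * of_real u * of_real s)) has_integral (?E R - ?E (-R))) {-R..R}"
      using assms by (intro fundamental_theorem_of_calculus) auto
    moreover have "?E R - ?E (-R) = complex_of_real (2 * dirichlet_kernel x R t)"
    proof -
      have "?E R - ?E (-R) = of_real (2 * sin (u * R) / u)"
      proof -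
        have "exp (\<i> * of_real u * of_real R) = cis (u * R)" "exp (\<i> * of_real u * of_real (-R)) = cis (- (u * R))"
          by (simp_all add: cis_conv_exp mult.assoc)
        moreover have "cis (u * R) - cis (- (u * R)) = 2 * \<i> * of_real (sin (u * R))"
          by (simp add: complex_eq_iff)
        then have "(cis (u * R) - cis (- (u * R))) / (\<i> * of_real u) = of_real (2 * sin (u * R) / u)"
          using False by simp
        ultimately show ?thesis by (simp add: diff_divide_distrib)
      qed
      moreover have "2 * sin (u * R) / u = 2 * dirichlet_kernel x R t"
      proof -
        have "R * (t - x) = - (u * R)" "t \<noteq> x" using False by (auto simp: u_def algebra_simps)
        then show ?thesis using False by (simp add: dirichlet_kernel_def)
      qed
      ultimately show ?thesis by simp
    qed
    ultimately show "((\<lambda>s. exp (\<i> * of_real u * of_real s)) has_integral complex_of_real (2 * dirichlet_kernel x R t)) {-R..R}"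
      by simp
  qed
qed

text \<open>
  The integrand is continuous on a compact rectangle, so the Lebesgue integrals agree with the gauge
  integrals and the order of integration may be exchanged.
\<close>

lemma truncated_fourier_inversion_eq_dirichlet:
  assumes f: "continuous_on {p..q} f" and R: "R \<ge> 0"
  shows "(LINT s:{-R..R}|lebesgue. exp (\<i> * complex_of_real x * complex_of_real s) *
            (LINT t:{p..q}|lebesgue. exp (- \<i> * complex_of_real s * complex_of_real t) * complex_of_real (f t)))
         = complex_of_real (2 * integral {p..q} (\<lambda>t. f t * dirichlet_kernel x R t))"
proof -
  let ?a = "\<lambda>s. exp (\<i> * complex_of_real x * complex_of_real s)"
  let ?b = "\<lambda>s t. exp (- \<i> * complex_of_real s * complex_of_real t)"
  have inner: "(LINT t:{p..q}|lebesgue. ?b s t * complex_of_real (f t)) = integral {p..q} (\<lambda>t. ?b s t * complex_of_real (f t))" for s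
    by (intro set_lebesgue_integral_eq_integral absolutely_integrable_continuous_real continuous_intros f)
  have f2: "continuous_on (A \<times> {p..q}) (\<lambda>z. f (snd z))" for A :: "real set"
    by (rule continuous_on_compose2[OF f continuous_on_snd[OF continuous_on_id]]) auto
  have cb: "continuous_on ({-R..R} \<times> cbox p q) (\<lambda>(s, t). ?b s t * complex_of_real (f t))"
    unfolding case_prod_unfold using f2 by (intro continuous_intros) auto
  have "(LINT s:{-R..R}|lebesgue. ?a s * (LINT t:{p..q}|lebesgue. ?b s t * complex_of_real (f t)))
     = integral {-R..R} (\<lambda>s. ?a s * integral {p..q} (\<lambda>t. ?b s t * complex_of_real (f t)))"
    unfolding inner using integral_continuous_on_param[OF cb]
    by (intro set_lebesgue_integral_eq_integral absolutely_integrable_continuous_real continuous_intros) auto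
  also have "\<dots> = integral {-R..R} (\<lambda>s. integral {p..q} (\<lambda>t. ?a s * ?b s t * complex_of_real (f t)))"
    by (simp add: mult.assoc)
  also have "\<dots> = integral {p..q} (\<lambda>t. integral {-R..R} (\<lambda>s. ?a s * ?b s t * complex_of_real (f t)))"
  proof -
    have "continuous_on (cbox (-R, p) (R, q)) (\<lambda>(s, t). ?a s * ?b s t * complex_of_real (f t))"
      unfolding case_prod_unfold cbox_Pair_eq using f2 by (intro continuous_intros) auto
    from integral_swap_continuous[OF this] show ?thesis by simp
  qed
  also have "\<dots> = integral {p..q} (\<lambda>t. complex_of_real (2 * (f t * dirichlet_kernel x R t)))"
  proof (rule arg_cong[where f = "integral {p..q}"], rule ext)
    fix t
    show "integral {-R..R} (\<lambda>s. ?a s * ?b s t * complex_of_real (f t)) = complex_of_real (2 * (f t * dirichlet_kernel x R t))"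
      using has_integral_mult_left[OF has_integral_exp_dirichlet_kernel[OF R, of x t], of "complex_of_real (f t)"]
      by (intro integral_unique) (simp add: mult_ac)
  qed
  also have "\<dots> = complex_of_real (2 * integral {p..q} (\<lambda>t. f t * dirichlet_kernel x R t))"
  proof -
    have "(\<lambda>t. f t * dirichlet_kernel x R t) integrable_on {p..q}"
      by (intro integrable_continuous_real continuous_intros continuous_on_dirichlet_kernel f)
    from has_integral_of_real[OF has_integral_mult_right[OF integrable_integral[OF this], of 2]]
    show ?thesis by (rule integral_unique)
  qed
  finally show ?thesis .
qed

theorem corollary2p5:
  fixes f :: "real \<Rightarrow> real" and x\<^sub>1 x\<^sub>2 x :: real
  assumes "x\<^sub>1 < x\<^sub>2"
    and "absolutely_continuous_on {x\<^sub>1..x\<^sub>2} f"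
    and "x\<^sub>1 < x" and "x < x\<^sub>2"
  shows "((\<lambda>R::real. 1 / (2 * complex_of_real pi) *
            (LINT s:{-R..R}|lebesgue. exp (\<i> * complex_of_real x * complex_of_real s) *
               (LINT t:{x\<^sub>1..x\<^sub>2}|lebesgue.
                  exp (- \<i> * complex_of_real s * complex_of_real t) * complex_of_real (f t))))
          \<longlongrightarrow> complex_of_real (f x)) at_top"
proof -
  let ?J = "\<lambda>R. integral {x\<^sub>1..x\<^sub>2} (\<lambda>t. f t * dirichlet_kernel x R t)"
  have f: "continuous_on {x\<^sub>1..x\<^sub>2} f"
    using assms(2) by (rule absolutely_continuous_on_imp_continuous_on)
  have "((\<lambda>R. complex_of_real (?J R / pi)) \<longlongrightarrow> complex_of_real (pi * f x / pi)) at_top"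
    using assms by (intro tendsto_intros dirichlet_integral_tendsto) auto
  then have "((\<lambda>R. 1 / (2 * complex_of_real pi) * complex_of_real (2 * ?J R)) \<longlongrightarrow> complex_of_real (f x)) at_top"
    by simp
  then show ?thesis
    by (rule Lim_transform_eventually)
       (use eventually_ge_at_top[of "0::real"] in eventually_elim,
        simp only: truncated_fourier_inversion_eq_dirichlet[OF f])
qed

end
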